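(* Let $G$ be a well-partitioned chordal graph and let $H$ be its minimal split decomposition. Then every component of $H$ is a split graph.
   Context: All graphs are finite, simple and connected. A connected graph $G=(V,E)$ is a well-partitioned chordal graph if there exist a partition $\mathcal{P}$ of $V$ and a tree $\mathcal{T}$ whose vertex set is $\mathcal{P}$ (the elements of $\mathcal{P}$ are called bags) such that: (1) each bag is a clique of $G$; (2) for every edge $AB$ of $\mathcal{T}$ there exist $A'\subseteq A$, $B'\subseteq B$ such that the edges of $G$ between $A$ and $B$ are exactly the pairs in $A'\times B'$; (3) for distinct bags $A,B$ not adjacent in $\mathcal{T}$ there are no edges of $G$ between $A$ and $B$. A split graph is a graph whose vertex set can be partitioned into a clique and an independent set. For $X\subseteq V$, $N_G(X)=\bigcup_{x\in X}N_G(x)\setminus X$. A split of a connected graph $G=(V,E)$ is a bipartition $\{V_1,V_2\}$ of $V$ with $|V_1|\ge 2$, $|V_2|\ge 2$, such that every vertex of $N_G(V_1)$ is adjacent to every vertex of $N_G(V_2)$. A graph with no split is prime. Given a split $\{V_1,V_2\}$, one decomposes $G$ into the two split components $G_1$ and $G_2$, where $G_1$ is obtained from $G[V_1]$ by adding a new vertex $v_1$ adjacent to every vertex of $N_G(V_2)$ (which lies in $V_1$), and $G_2$ is obtained from $G[V_2]$ by adding a new vertex $v_2$ adjacent to every vertex of $N_G(V_1)$; the new vertices $v_1,v_2$ are marked as linked. Applying this recursively to components yields a split decomposition of $G$. A minimal split decomposition is a split decomposition all of whose components are cliques, stars or prime graphs and whose number of components is minimum; it is unique. *)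

theory Defs
  imports "Graph_Theory.Graph_Theory" "HOL-Library.Disjoint_Sets"
begin

text \<open>A finite simple graph is a \<^const>\<open>pair_graph\<close>: an edge \<open>uv\<close> is represented by the two
  arcs \<open>(u, v)\<close> and \<open>(v, u)\<close>.\<close>

definition clique :: "'a pair_pre_digraph \<Rightarrow> 'a set \<Rightarrow> bool" where
  "clique G K \<longleftrightarrow> K \<subseteq> pverts G \<and> (\<forall>u\<in>K. \<forall>v\<in>K. u \<noteq> v \<longrightarrow> (u, v) \<in> parcs G)"

definition independent :: "'a pair_pre_digraph \<Rightarrow> 'a set \<Rightarrow> bool" where
  "independent G I \<longleftrightarrow> I \<subseteq> pverts G \<and> (\<forall>u\<in>I. \<forall>v\<in>I. (u, v) \<notin> parcs G)"

definition split_graph :: "'a pair_pre_digraph \<Rightarrow> bool" where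
  "split_graph G \<longleftrightarrow>
     (\<exists>K I. K \<union> I = pverts G \<and> K \<inter> I = {} \<and> clique G K \<and> independent G I)"

text \<open>The library predicate \<^const>\<open>tree\<close> does not fit here: every edge \<open>uv\<close> of a symmetric digraph
  gives the directed cycle \<open>u, v, u\<close>. The cycles of the undirected graph are those of length at
  least 3.\<close>

definition undirected_tree :: "'a pair_pre_digraph \<Rightarrow> bool" where
  "undirected_tree T \<longleftrightarrow> pair_graph T \<and> connected T \<and>
     \<not> (\<exists>p. pre_digraph.cycle T p \<and> length p \<ge> 3)"

definition well_partitioned_chordal :: "'a pair_pre_digraph \<Rightarrow> bool" where
  "well_partitioned_chordal G \<longleftrightarrow> pair_graph G \<and> connected G \<and>
     (\<exists>P T. partition_on (pverts G) P \<and> undirected_tree T \<and> pverts T = P \<and>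
        (\<forall>A\<in>P. clique G A) \<and>
        (\<forall>A B. (A, B) \<in> parcs T \<longrightarrow>
           (\<exists>A' B'. A' \<subseteq> A \<and> B' \<subseteq> B \<and> parcs G \<inter> (A \<times> B) = A' \<times> B')) \<and>
        (\<forall>A\<in>P. \<forall>B\<in>P. A \<noteq> B \<and> (A, B) \<notin> parcs T \<longrightarrow> parcs G \<inter> (A \<times> B) = {}))"

definition neighbourhood :: "'a pair_pre_digraph \<Rightarrow> 'a set \<Rightarrow> 'a set" where
  "neighbourhood G X = (\<Union>x\<in>X. {y. (x, y) \<in> parcs G}) - X"

definition is_split :: "'a pair_pre_digraph \<Rightarrow> 'a set \<Rightarrow> 'a set \<Rightarrow> bool" where
  "is_split G V1 V2 \<longleftrightarrow>
     V1 \<union> V2 = pverts G \<and> V1 \<inter> V2 = {} \<and> card V1 \<ge> 2 \<and> card V2 \<ge> 2 \<and>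
     (\<forall>x\<in>neighbourhood G V1. \<forall>y\<in>neighbourhood G V2. (x, y) \<in> parcs G)"

definition prime_graph :: "'a pair_pre_digraph \<Rightarrow> bool" where
  "prime_graph G \<longleftrightarrow> \<not> (\<exists>V1 V2. is_split G V1 V2)"

definition complete_graph :: "'a pair_pre_digraph \<Rightarrow> bool" where
  "complete_graph G \<longleftrightarrow> clique G (pverts G)"

definition star_graph :: "'a pair_pre_digraph \<Rightarrow> bool" where
  "star_graph G \<longleftrightarrow> (\<exists>c\<in>pverts G.
     parcs G = {c} \<times> (pverts G - {c}) \<union> (pverts G - {c}) \<times> {c})"

text \<open>For a split \<open>{V1, V2}\<close> the two components are \<open>split_component G V1 V2 v1\<close> and
  \<open>split_component G V2 V1 v2\<close>.\<close>

definition split_component ::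
  "'a pair_pre_digraph \<Rightarrow> 'a set \<Rightarrow> 'a set \<Rightarrow> 'a \<Rightarrow> 'a pair_pre_digraph" where
  "split_component G X Y v =
     \<lparr> pverts = insert v X,
       parcs = arcs (with_proj G \<restriction> X)
                 \<union> {v} \<times> neighbourhood G Y \<union> neighbourhood G Y \<times> {v} \<rparr>"

text \<open>The vertices of a split decomposition are the original vertices and an unlimited supply of
  names for the new, marked vertices.\<close>

datatype 'a dvert = Orig 'a | Marker nat

definition orig_graph :: "'a pair_pre_digraph \<Rightarrow> 'a dvert pair_pre_digraph" where
  "orig_graph G = \<lparr> pverts = Orig ` pverts G, parcs = map_prod Orig Orig ` parcs G \<rparr>"

text \<open>The components of a decomposition are nonempty and pairwise vertex-disjoint, because new
  vertices are always fresh; a set of components therefore never identifies two of them.\<close>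

record 'a decomposition =
  components :: "'a dvert pair_pre_digraph set"
  links :: "'a dvert set set"

definition dverts :: "'a decomposition \<Rightarrow> 'a dvert set" where
  "dverts D = (\<Union>C\<in>components D. pverts C)"

inductive split_decomposition :: "'a pair_pre_digraph \<Rightarrow> 'a decomposition \<Rightarrow> bool"
  for G :: "'a pair_pre_digraph" where
  trivial: "split_decomposition G \<lparr> components = {orig_graph G}, links = {} \<rparr>"
| decompose: "split_decomposition G
     \<lparr> components = (components D - {C}) \<union>
         {split_component C V1 V2 (Marker m1), split_component C V2 V1 (Marker m2)},
       links = insert {Marker m1, Marker m2} (links D) \<rparr>"
  if "split_decomposition G D" "C \<in> components D" "is_split C V1 V2"
     "Marker m1 \<notin> dverts D" "Marker m2 \<notin> dverts D" "m1 \<noteq> m2"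

definition reduced_split_decomposition :: "'a pair_pre_digraph \<Rightarrow> 'a decomposition \<Rightarrow> bool" where
  "reduced_split_decomposition G D \<longleftrightarrow> split_decomposition G D \<and>
     (\<forall>C\<in>components D. complete_graph C \<or> star_graph C \<or> prime_graph C)"

definition minimal_split_decomposition :: "'a pair_pre_digraph \<Rightarrow> 'a decomposition \<Rightarrow> bool" where
  "minimal_split_decomposition G D \<longleftrightarrow> reduced_split_decomposition G D \<and>
     (\<forall>D'. reduced_split_decomposition G D' \<longrightarrow> card (components D) \<le> card (components D'))"

end

theory Submission
  imports Defs
begin

text \<open>In a connected graph, both components of a split are induced subgraphs up to isomorphism: the
  marked vertex behaves like any vertex on the opposite side with a neighbour across the split.
  Hence every component \<open>C\<close> of a split decomposition of \<open>G\<close> embeds into \<open>G\<close> as an induced subgraph,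
  and its vertices are distributed over the bags of \<open>G\<close>.

  Every edge of the tree of bags cuts \<open>C\<close> into two parts whose cross edges form a complete bipartite
  graph, so if \<open>C\<close> is prime then one part has at most one vertex. Descending along the edges towards
  the large part ends in a bag \<open>K\<close> such that every branch of the tree at \<open>K\<close> contains at most one
  vertex of \<open>C\<close>. Then \<open>C\<close> is the union of a clique, its vertices in \<open>K\<close>, and an independent set.\<close>

section \<open>Sides of the edges of a tree\<close>

text \<open>In a tree this is the component containing \<open>b\<close> once the edge
  \<open>ab\<close> is deleted. An undirected edge is a pair of arcs, so both go.\<close>

definition side :: "'b rel \<Rightarrow> 'b \<Rightarrow> 'b \<Rightarrow> 'b set" where
  "side E a b = {x. (b, x) \<in> (E - {(a, b), (b, a)})\<^sup>*}"

lemma side_self: "b \<in> side E a b"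
  by (simp add: side_def)

lemma side_step:
  "x \<in> side E a b \<Longrightarrow> (x, y) \<in> E \<Longrightarrow> (x, y) \<noteq> (a, b) \<Longrightarrow> (x, y) \<noteq> (b, a) \<Longrightarrow> y \<in> side E a b"
  by (auto simp: side_def intro: rtrancl_into_rtrancl)

lemma finite_side:
  assumes "finite E" shows "finite (side E a b)"
proof -
  have "x \<in> insert b (Range E)" if "x \<in> side E a b" for x
    using that unfolding side_def by (auto elim: rtranclE)
  then show ?thesis
    using assms by (meson finite.insertI finite_Range finite_subset subsetI)
qed

text \<open>Finite forests in relational form: \<open>bridge\<close> is acyclicity, stated as every
  edge being a bridge. Connectedness enters separately, as reachability from a fixed vertex.\<close>

locale tree_rel =
  fixes E :: "'b rel"
  assumes sym: "(x, y) \<in> E \<Longrightarrow> (y, x) \<in> E"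
    and fin: "finite E"
    and bridge: "(a, b) \<in> E \<Longrightarrow> a \<notin> side E a b"
begin

lemma irrefl: "(a, a) \<notin> E"
  using bridge side_self by metis

lemma side_cross:
  assumes "(a, b) \<in> E" "x \<in> side E a b" "y \<notin> side E a b" "(x, y) \<in> E"
  shows "x = b \<and> y = a"
  using assms side_step[of x E a b y] bridge by auto

text \<open>This drives the descent. A walk from \<open>d\<close> that avoids the bridge
  \<open>bd\<close> never meets \<open>b\<close>, hence cannot use the edge \<open>ab\<close>
  either. The inclusion is strict because of \<open>b\<close> itself.\<close>

lemma side_psubset:
  assumes ab: "(a, b) \<in> E" and bd: "(b, d) \<in> E" and "d \<noteq> a"
  shows "side E b d \<subset> side E a b"
proof -
  have b: "b \<notin> side E b d" using bridge bd by blast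
  have "x \<in> side E a b" if "(d, x) \<in> (E - {(b, d), (d, b)})\<^sup>*" for x
    using that
  proof (induction rule: rtrancl_induct)
    case base
    show ?case using side_step[OF side_self bd] assms irrefl by auto
  next
    case (step x y)
    have "x \<in> side E b d" "y \<in> side E b d"
      using step.hyps(1) rtrancl_into_rtrancl[OF step.hyps] by (simp_all add: side_def)
    then have "x \<noteq> b" "y \<noteq> b" using b by auto
    then show ?case using side_step[OF step.IH] step.hyps(2) by simp
  qed
  then show ?thesis using b side_self by (fastforce simp: side_def)
qed

text \<open>Follow the walk: each step out of \<open>k\<close> selects a new branch, and a step
  between vertices other than \<open>k\<close> stays in the current one.\<close>

lemma in_side_of_neighbour:
  assumes "(k, x) \<in> E\<^sup>*" "x \<noteq> k"
  shows "\<exists>b. (k, b) \<in> E \<and> x \<in> side E k b"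
  using assms
proof (induction rule: rtrancl_induct)
  case (step x y)
  show ?case
  proof (cases "x = k")
    case True
    then show ?thesis using step side_self by metis
  next
    case False
    then show ?thesis using step side_step[of x E k _ y] by blast
  qed
qed auto

text \<open>The witness \<open>k\<close> is the head of an arc whose side is minimal among the big ones.\<close>

lemma small_branches:
  assumes one: "\<And>a b. (a, b) \<in> E \<Longrightarrow> \<not> (big (side E a b) \<and> big (side E b a))"
    and "V \<noteq> {}"
  shows "\<exists>k\<in>V \<union> Field E. \<forall>b. (k, b) \<in> E \<longrightarrow> \<not> big (side E k b)"
proof (cases "\<exists>a b. (a, b) \<in> E \<and> big (side E a b)")
  \<comment> \<open>Any element of \<open>V\<close> works here. This covers the tree with a single
    vertex, whose edge relation has an empty field.\<close>
  case False
  then show ?thesis using \<open>V \<noteq> {}\<close> by blast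
next
  case True
  define Q where "Q = (\<lambda>(a, b). (a, b) \<in> E \<and> big (side E a b))"
  obtain a b where ab: "Q (a, b)"
    and least: "\<And>c d. Q (c, d) \<Longrightarrow> card (side E a b) \<le> card (side E c d)"
  proof -
    from True obtain e where "Q e" by (auto simp: Q_def)
    then obtain e where "Q e" "\<And>e'. Q e' \<Longrightarrow> card (case_prod (side E) e) \<le> card (case_prod (side E) e')"
      using ex_has_least_nat[of Q e "\<lambda>e. card (case_prod (side E) e)"] by blast
    then show thesis by (cases e) (use that in fastforce)
  qed
  \<comment> \<open>Turning back to \<open>a\<close> is excluded by \<open>one\<close>; going on to
    another neighbour would give a smaller big side.\<close>
  have "\<not> big (side E b d)" if bd: "(b, d) \<in> E" for d
  proof (cases "d = a")
    case True
    then show ?thesis using one ab by (auto simp: Q_def)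
  next
    case False
    have "side E b d \<subset> side E a b"
      using side_psubset[OF _ bd False] ab by (auto simp: Q_def)
    then have "card (side E b d) < card (side E a b)"
      by (rule psubset_card_mono[OF finite_side[OF fin]])
    then show ?thesis using least[of b d] bd by (auto simp: Q_def)
  qed
  moreover have "b \<in> Field E" using ab by (auto simp: Q_def Field_def)
  ultimately show ?thesis by blast
qed

end

section \<open>Undirected trees as relations in which every edge is a bridge\<close>

lemma connected_imp_rtrancl:
  assumes "pair_graph G" "connected G" "u \<in> pverts G" "v \<in> pverts G"
  shows "(u, v) \<in> (parcs G)\<^sup>*"
proof -
  interpret pair_graph G by fact
  \<comment> \<open>\<open>connected\<close> refers to the symmetric closure, which adds nothing
    because arcs already come in opposite pairs.\<close>
  have "parcs (mk_symmetric (with_proj G)) = parcs G"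
    by (auto simp: parcs_mk_symmetric intro: arcs_symmetric)
  then show ?thesis
    using assms
    by (auto simp: connected_def strongly_connected_def reachable_def intro: rtrancl_on_rtranclI)
qed

text \<open>If \<open>ab\<close> were not a bridge, a simple path from \<open>b\<close> to
  \<open>a\<close> avoiding it would close up with the arc \<open>(a, b)\<close> to a cycle.\<close>

lemma undirected_tree_tree_rel:
  assumes "undirected_tree T"
  shows "tree_rel (parcs T)"
proof -
  interpret pair_graph T using assms by (simp add: undirected_tree_def)
  show ?thesis
  proof
    show "(y, x) \<in> parcs T" if "(x, y) \<in> parcs T" for x y
      using that by (rule arcs_symmetric)
    show "finite (parcs T)" by (rule pair_finite_arcs)
  next
    fix a b assume ab: "(a, b) \<in> parcs T"
    show "a \<notin> side (parcs T) a b"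
    proof
      assume a: "a \<in> side (parcs T) a b"
      define T' where "T' = \<lparr> pverts = pverts T, parcs = parcs T - {(a, b), (b, a)} \<rparr>"
      interpret T': pair_wf_digraph T'
        by unfold_locales (auto simp: T'_def intro: wellformed')
      have "(b, a) \<in> (parcs T')\<^sup>*" using a by (simp add: side_def T'_def)
      moreover have "a \<in> pverts T'" "b \<in> pverts T'"
        using ab by (auto simp: T'_def intro: wellformed')
      ultimately have "b \<rightarrow>\<^sup>*\<^bsub>T'\<^esub> a"
        unfolding reachable_def
        by (auto intro!: rtrancl_consistent_rtrancl_on dest: T'.wellformed')
      then obtain p where p: "T'.apath b p a"
        using T'.reachable_apath by blast
      then have "b \<in> pverts T'" "set p \<subseteq> parcs T'" "pcas b p a"
        and dist: "distinct (pawalk_verts b p)"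
        unfolding T'.apath_def T'.awalk_def by auto
      then have walk: "awalk b p a" and sub: "set p \<subseteq> parcs T - {(a, b), (b, a)}"
        by (auto simp: awalk_def T'_def)
      have "cycle ((a, b) # p)"
        using walk dist ab by (auto simp: cycle_def awalk_Cons_iff)
      \<comment> \<open>The path is not empty since \<open>a\<close> and \<open>b\<close> differ,
        and not a single arc since \<open>(b, a)\<close> was deleted.\<close>
      moreover have "length ((a, b) # p) \<ge> 3"
      proof -
        have "a \<noteq> b" using ab no_loops' by blast
        then show ?thesis
          using walk sub
          by (cases p; cases "tl p") (auto simp: awalk_simps)
      qed
      ultimately show False using assms by (auto simp: undirected_tree_def)
    qed
  qed
qed

section \<open>Components of split decompositions are induced subgraphs\<close>

text \<open>An isomorphism onto an induced subgraph. Equating the arc sets also confines the arcs of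
  \<open>C\<close> to its vertices and carries symmetry over from \<open>G\<close>.\<close>

definition induced_embedding :: "('b \<Rightarrow> 'a) \<Rightarrow> 'b pair_pre_digraph \<Rightarrow> 'a pair_pre_digraph \<Rightarrow> bool" where
  "induced_embedding f C G \<longleftrightarrow> inj_on f (pverts C) \<and> f ` pverts C \<subseteq> pverts G \<and>
     parcs C = {(u, v). u \<in> pverts C \<and> v \<in> pverts C \<and> (f u, f v) \<in> parcs G}"

text \<open>Connectedness in terms of cuts rather than walks: a cut of a split component can be
  compared directly with a cut of the graph that was split.\<close>

definition cut_connected :: "'b pair_pre_digraph \<Rightarrow> bool" where
  "cut_connected C \<longleftrightarrow>
     (\<forall>X. X \<subseteq> pverts C \<and> X \<noteq> {} \<and> X \<noteq> pverts C \<longrightarrow>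
        (\<exists>x\<in>X. \<exists>y\<in>pverts C - X. (x, y) \<in> parcs C))"

lemma connected_imp_cut_connected:
  assumes "pair_graph G" "connected G"
  shows "cut_connected G"
  unfolding cut_connected_def
proof (intro allI impI, elim conjE)
  interpret pair_graph G by fact
  fix X assume X: "X \<subseteq> pverts G" "X \<noteq> {}" "X \<noteq> pverts G"
  then obtain u v where uv: "u \<in> X" "v \<in> pverts G" "v \<notin> X" by blast
  then have "(u, v) \<in> (parcs G)\<^sup>*" using connected_imp_rtrancl[OF assms] X by blast
  then have "v \<in> X \<or> (\<exists>x\<in>X. \<exists>y\<in>pverts G - X. (x, y) \<in> parcs G)"
    by (induction rule: rtrancl_induct) (use uv in \<open>auto dest: in_arcsD2\<close>)
  then show "\<exists>x\<in>X. \<exists>y\<in>pverts G - X. (x, y) \<in> parcs G" using uv by blast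
qed

text \<open>No vertex of \<open>orig_graph G\<close> is a \<open>Marker\<close>, so the value
  \<open>undefined\<close> is never met.\<close>

lemma induced_embedding_orig_graph:
  assumes "pair_graph G"
  shows "induced_embedding (case_dvert id undefined) (orig_graph G) G"
proof -
  interpret pair_graph G by fact
  show ?thesis
    by (auto simp: induced_embedding_def orig_graph_def inj_on_def dest: wellformed')
qed

lemma cut_connected_orig_graph:
  assumes "cut_connected G"
  shows "cut_connected (orig_graph G)"
  unfolding cut_connected_def
proof (intro allI impI, elim conjE)
  fix X assume X: "X \<subseteq> pverts (orig_graph G)" "X \<noteq> {}" "X \<noteq> pverts (orig_graph G)"
  define Y where "Y = {x \<in> pverts G. Orig x \<in> X}"
  have XY: "X = Orig ` Y" using X by (auto simp: Y_def orig_graph_def)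
  have "Y \<subseteq> pverts G" "Y \<noteq> {}" "Y \<noteq> pverts G"
    using X unfolding XY by (auto simp: orig_graph_def)
  then obtain x y where "x \<in> Y" "y \<in> pverts G - Y" "(x, y) \<in> parcs G"
    using assms unfolding cut_connected_def by metis
  then have "Orig x \<in> X" "Orig y \<in> pverts (orig_graph G) - X"
    "(Orig x, Orig y) \<in> parcs (orig_graph G)"
    unfolding XY by (auto simp: orig_graph_def)
  then show "\<exists>x\<in>X. \<exists>y\<in>pverts (orig_graph G) - X. (x, y) \<in> parcs (orig_graph G)" by blast
qed

lemma is_split_commute:
  assumes "is_split C V1 V2" "\<And>u v. (u, v) \<in> parcs C \<Longrightarrow> (v, u) \<in> parcs C"
  shows "is_split C V2 V1"
  using assms by (auto simp: is_split_def)

lemma split_component_simps: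
  "pverts (split_component C X Y v) = insert v X"
  "parcs (split_component C X Y v) = parcs C \<inter> X \<times> X
     \<union> {v} \<times> neighbourhood C Y \<union> neighbourhood C Y \<times> {v}"
  by (auto simp: split_component_def induce_subgraph_def)

lemma induced_embedding_sym:
  assumes "pair_graph G" "induced_embedding f C G" "(u, v) \<in> parcs C"
  shows "(v, u) \<in> parcs C"
proof -
  interpret pair_graph G by fact
  show ?thesis using assms by (auto simp: induced_embedding_def intro: arcs_symmetric)
qed

text \<open>The two properties are carried together: connectedness supplies the vertex that
  represents the marker, so it must survive for the next split.\<close>

lemma split_component_invariant:
  assumes G: "pair_graph G" and emb: "induced_embedding f C G" and conn: "cut_connected C"
    and split: "is_split C V1 V2" and v: "v \<notin> pverts C"
  shows "(\<exists>f'. induced_embedding f' (split_component C V1 V2 v) G)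
    \<and> cut_connected (split_component C V1 V2 v)"
proof -
  interpret pair_graph G by fact
  have symC: "(y, x) \<in> parcs C" if "(x, y) \<in> parcs C" for x y
    using induced_embedding_sym[OF G emb that] .
  have wfC: "x \<in> pverts C" "y \<in> pverts C" if "(x, y) \<in> parcs C" for x y
    using that emb by (auto simp: induced_embedding_def)
  have V: "V1 \<union> V2 = pverts C" "V1 \<inter> V2 = {}" and ne: "V1 \<noteq> {}" "V2 \<noteq> {}"
    using split by (auto simp: is_split_def)
  obtain x0 w where w: "x0 \<in> V1" "w \<in> V2" "(x0, w) \<in> parcs C"
  proof -
    have "V1 \<subseteq> pverts C" "V1 \<noteq> pverts C" using V ne by auto
    then show thesis using conn ne V that unfolding cut_connected_def
      by (metis DiffE UnE)
  qed
  have N: "x \<in> neighbourhood C V2 \<longleftrightarrow> x \<in> V1 \<and> (\<exists>y\<in>V2. (x, y) \<in> parcs C)" for x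
    using V by (auto simp: neighbourhood_def dest: wfC symC)
  have wN: "w \<in> neighbourhood C V1" using w V by (auto simp: neighbourhood_def)
  \<comment> \<open>By the split condition \<open>w\<close> sees all of the frontier of
    \<open>V1\<close>, so its neighbours in \<open>V1\<close> are exactly those of the
    marker.\<close>
  have Nw: "x \<in> neighbourhood C V2 \<longleftrightarrow> x \<in> V1 \<and> (x, w) \<in> parcs C" for x
    using split wN N[of x] w(2) symC[of w x] unfolding is_split_def by blast
  have arcs: "(x, y) \<in> parcs C \<longleftrightarrow> (f x, f y) \<in> parcs G" if "x \<in> pverts C" "y \<in> pverts C" for x y
    using emb that by (auto simp: induced_embedding_def)
  \<comment> \<open>The marker takes over the image of \<open>w\<close>, which is free because
    \<open>w\<close> lies outside \<open>V1\<close>.\<close>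
  let ?f = "f(v := f w)" and ?C = "split_component C V1 V2 v"
  have v': "v \<notin> V1" using v V by auto
  have inV: "x \<in> pverts C" if "x \<in> V1 \<or> x = w" for x using that V w by auto
  have "induced_embedding ?f ?C G"
    unfolding induced_embedding_def split_component_simps
  proof (intro conjI)
    have inj: "inj_on f (pverts C)" using emb by (simp add: induced_embedding_def)
    have "f w \<notin> f ` V1"
      using inj_onD[OF inj, of w] inV w V by blast
    moreover have "inj_on f V1" using inj inV by (meson inj_on_subset subsetI)
    ultimately show "inj_on ?f (insert v V1)"
      using v' by (auto simp: inj_on_def image_iff)
    show "?f ` insert v V1 \<subseteq> pverts G"
      using emb inV by (auto simp: induced_embedding_def)
    \<comment> \<open>For \<open>x = y = v\<close> the equivalence rests on \<open>G\<close> having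
      no loop at \<open>f w\<close>.\<close>
    have "(x, y) \<in> parcs C \<inter> V1 \<times> V1 \<union> {v} \<times> neighbourhood C V2 \<union> neighbourhood C V2 \<times> {v}
      \<longleftrightarrow> x \<in> insert v V1 \<and> y \<in> insert v V1 \<and> (?f x, ?f y) \<in> parcs G" for x y
      using arcs[of x y] arcs[of x w] arcs[of y w] arcs[of w y] arcs_symmetric[of "f y" "f w"]
        arcs_symmetric[of "f w" "f y"] inV v' no_loops'[of "f w" "f w"]
      by (cases "x = v"; cases "y = v") (auto simp: Nw)
    then show "parcs C \<inter> V1 \<times> V1 \<union> {v} \<times> neighbourhood C V2 \<union> neighbourhood C V2 \<times> {v}
      = {(x, y). x \<in> insert v V1 \<and> y \<in> insert v V1 \<and> (?f x, ?f y) \<in> parcs G}"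
      unfolding set_eq_iff split_paired_All mem_Collect_eq case_prod_conv by blast
  qed
  moreover have "cut_connected ?C"
  proof -
    have symD: "(y, x) \<in> parcs ?C" if "(x, y) \<in> parcs ?C" for x y
      using that symC by (auto simp: split_component_simps)
    \<comment> \<open>An arc of \<open>C\<close> leaving \<open>X\<close> either ends in
      \<open>V1\<close> or crosses the split; in the latter case its tail is joined to the marker
      \<open>v\<close>, which is outside \<open>X\<close>.\<close>
    have main: "\<exists>x\<in>X. \<exists>y\<in>pverts ?C - X. (x, y) \<in> parcs ?C"
      if X: "X \<subseteq> V1" "X \<noteq> {}" for X
    proof -
      have "X \<subseteq> pverts C" "X \<noteq> pverts C" using X V ne by auto
      then obtain x y where xy: "x \<in> X" "y \<in> pverts C - X" "(x, y) \<in> parcs C"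
        using conn X unfolding cut_connected_def by metis
      show ?thesis
      proof (cases "y \<in> V1")
        case True
        then show ?thesis using xy X by (auto simp: split_component_simps)
      next
        case False
        then have "x \<in> neighbourhood C V2" using xy X V N by blast
        then show ?thesis using xy X v' by (auto simp: split_component_simps)
      qed
    qed
    show ?thesis
      unfolding cut_connected_def
    proof (intro allI impI, elim conjE)
      fix X assume X: "X \<subseteq> pverts ?C" "X \<noteq> {}" "X \<noteq> pverts ?C"
      show "\<exists>x\<in>X. \<exists>y\<in>pverts ?C - X. (x, y) \<in> parcs ?C"
      proof (cases "v \<in> X")
        case False
        then show ?thesis using main[of X] X by (auto simp: split_component_simps)
      next
        \<comment> \<open>The complement avoids \<open>v\<close>, so \<open>main\<close> applies to
          it, and the arc found is reversed.\<close>
        case True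
        then have "pverts ?C - X \<subseteq> V1" "pverts ?C - X \<noteq> {}"
          using X by (auto simp: split_component_simps)
        then obtain x y where "x \<in> pverts ?C - X" "y \<in> pverts ?C - (pverts ?C - X)" "(x, y) \<in> parcs ?C"
          using main by metis
        then show ?thesis using symD by blast
      qed
    qed
  qed
  ultimately show ?thesis by blast
qed

lemma split_decomposition_invariant:
  assumes G: "pair_graph G" "connected G" and "split_decomposition G D" "C \<in> components D"
  shows "(\<exists>f. induced_embedding f C G) \<and> cut_connected C"
  using assms(3,4)
proof (induction arbitrary: C rule: split_decomposition.induct)
  case trivial
  then show ?case
    using induced_embedding_orig_graph[OF G(1)]
      cut_connected_orig_graph[OF connected_imp_cut_connected[OF G]] by auto
next
  case (decompose D C0 V1 V2 m1 m2)
  from decompose.IH[OF decompose.hyps(2)] obtain f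
    where f: "induced_embedding f C0 G" and conn: "cut_connected C0" by blast
  have fresh: "Marker m1 \<notin> pverts C0" "Marker m2 \<notin> pverts C0"
    using decompose.hyps by (auto simp: dverts_def)
  \<comment> \<open>The second component is the first one with the two sides exchanged.\<close>
  have split': "is_split C0 V2 V1"
    using is_split_commute decompose.hyps(3) induced_embedding_sym[OF G(1) f] by blast
  show ?case
    using decompose.prems decompose.IH
      split_component_invariant[OF G(1) f conn decompose.hyps(3) fresh(1)]
      split_component_invariant[OF G(1) f conn split' fresh(2)]
    by auto
qed

section \<open>Prime induced subgraphs of well-partitioned chordal graphs\<close>

lemma prime_induced_imp_split_graph:
  assumes wpc: "well_partitioned_chordal G" and emb: "induced_embedding f C G"
    and prime: "prime_graph C"
  shows "split_graph C"
proof -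
  from wpc obtain P T where G: "pair_graph G" and part: "partition_on (pverts G) P"
    and T: "undirected_tree T" "pverts T = P"
    and bags: "\<forall>A\<in>P. clique G A"
    and adj: "\<forall>A B. (A, B) \<in> parcs T \<longrightarrow>
      (\<exists>A' B'. A' \<subseteq> A \<and> B' \<subseteq> B \<and> parcs G \<inter> (A \<times> B) = A' \<times> B')"
    and nonadj: "\<forall>A\<in>P. \<forall>B\<in>P. A \<noteq> B \<and> (A, B) \<notin> parcs T \<longrightarrow> parcs G \<inter> (A \<times> B) = {}"
    unfolding well_partitioned_chordal_def by (elim conjE exE)
  interpret G: pair_graph G by fact
  interpret T: pair_graph T using T by (simp add: undirected_tree_def)
  interpret E: tree_rel "parcs T" using T by (intro undirected_tree_tree_rel)
  have Pne: "P \<noteq> {}"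
    using T by (auto simp: undirected_tree_def connected_def strongly_connected_def)
  have finC: "finite (pverts C)"
    using emb G.pair_finite_verts unfolding induced_embedding_def
    by (metis finite_imageD finite_subset)
  have fV: "f u \<in> pverts G" if "u \<in> pverts C" for u
    using emb that by (auto simp: induced_embedding_def)
  have arcs: "(u, v) \<in> parcs C \<longleftrightarrow> u \<in> pverts C \<and> v \<in> pverts C \<and> (f u, f v) \<in> parcs G" for u v
    using emb by (auto simp: induced_embedding_def)
  have symC: "(v, u) \<in> parcs C" if "(u, v) \<in> parcs C" for u v
    using induced_embedding_sym[OF G emb that] .
  have "\<forall>u\<in>pverts C. \<exists>A. A \<in> P \<and> f u \<in> A"
    using fV partition_onD1[OF part] by blast
  then obtain bag where bag: "\<And>u. u \<in> pverts C \<Longrightarrow> bag u \<in> P \<and> f u \<in> bag u"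
    by metis
  have bag_adj: "bag u = bag v \<or> (bag u, bag v) \<in> parcs T" if "(u, v) \<in> parcs C" for u v
    using that nonadj[rule_format, of "bag u" "bag v"] bag[of u] bag[of v] arcs[of u v] by blast
  \<comment> \<open>The threshold 2 is the least size of a part of a split.\<close>
  define big where "big S \<longleftrightarrow> card {u \<in> pverts C. bag u \<in> S} \<ge> 2" for S
  have not_both: "\<not> (big (side (parcs T) A B) \<and> big (side (parcs T) B A))"
    if AB: "(A, B) \<in> parcs T" for A B
  proof
    assume big: "big (side (parcs T) A B) \<and> big (side (parcs T) B A)"
    let ?S = "side (parcs T) A B"
    define V1 where "V1 = {u \<in> pverts C. bag u \<in> ?S}"
    \<comment> \<open>Taking the complement makes \<open>V1\<close> and \<open>V2\<close> a
      bipartition at once; \<open>disj\<close> then shows that \<open>V2\<close> contains all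
      vertices over the other side.\<close>
    define V2 where "V2 = {u \<in> pverts C. bag u \<notin> ?S}"
    have disj: "X \<notin> ?S" if "X \<in> side (parcs T) B A" for X
    proof -
      have "(A, X) \<in> (parcs T - {(A, B), (B, A)})\<^sup>*"
        using that by (simp add: side_def insert_commute)
      then show ?thesis
      proof (induction rule: rtrancl_induct)
        case base
        show ?case using E.bridge[OF AB] .
      next
        case (step X Y)
        then show ?case using side_step[of Y "parcs T" A B X] E.sym by blast
      qed
    qed
    have "card {u \<in> pverts C. bag u \<in> side (parcs T) B A} \<le> card V2"
      unfolding V2_def using finC disj by (intro card_mono) auto
    then have card: "card V1 \<ge> 2" "card V2 \<ge> 2"
      using big by (auto simp: big_def V1_def)
    \<comment> \<open>Edges of \<open>C\<close> between the parts lie over the single tree edge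
      \<open>AB\<close>.\<close>
    have cross: "bag u = B \<and> bag v = A" if "u \<in> V1" "v \<in> V2" "(u, v) \<in> parcs C" for u v
    proof -
      have "bag u \<in> ?S" "bag v \<notin> ?S" using that by (auto simp: V1_def V2_def)
      moreover from this have "(bag u, bag v) \<in> parcs T" using bag_adj that by metis
      ultimately show ?thesis using E.side_cross[OF AB] by blast
    qed
    obtain A' B' where A'B': "parcs G \<inter> (A \<times> B) = A' \<times> B'" using adj[rule_format, OF AB] by blast
    have AB': "f v \<in> A' \<and> f u \<in> B'" if "u \<in> V1" "v \<in> V2" "(u, v) \<in> parcs C" for u v
    proof -
      have "(f v, f u) \<in> parcs G \<inter> (A \<times> B)"
        using cross[OF that] bag[of u] bag[of v] symC[OF that(3)] arcs[of v u] by auto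
      then show ?thesis unfolding A'B' by auto
    qed
    have "is_split C V1 V2"
      unfolding is_split_def
    proof (intro conjI ballI card)
      show "V1 \<union> V2 = pverts C" "V1 \<inter> V2 = {}" by (auto simp: V1_def V2_def)
      fix x y assume "x \<in> neighbourhood C V1" "y \<in> neighbourhood C V2"
      then obtain u v where uv: "u \<in> V1" "(u, x) \<in> parcs C" "x \<notin> V1"
        "v \<in> V2" "(v, y) \<in> parcs C" "y \<notin> V2"
        by (auto simp: neighbourhood_def)
      then have xy: "x \<in> V2" "y \<in> V1" "x \<in> pverts C" "y \<in> pverts C"
        using arcs by (auto simp: V1_def V2_def)
      \<comment> \<open>Frontier vertices map into \<open>A'\<close> and \<open>B'\<close>, and all
        pairs in \<open>A' \<times> B'\<close> are arcs of \<open>G\<close>.\<close>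
      have "f x \<in> A'" "f y \<in> B'" using AB' uv xy symC by blast+
      then have "(f x, f y) \<in> parcs G" using A'B' by blast
      then show "(x, y) \<in> parcs C" using arcs xy by blast
    qed
    then show False using prime by (auto simp: prime_graph_def)
  qed
  obtain K where KP: "K \<in> P" and K: "\<And>B. (K, B) \<in> parcs T \<Longrightarrow> \<not> big (side (parcs T) K B)"
  proof -
    have "Field (parcs T) \<subseteq> P"
      using T(2) by (auto simp: Field_def dest: T.wellformed')
    moreover have "\<exists>K\<in>P \<union> Field (parcs T). \<forall>B. (K, B) \<in> parcs T \<longrightarrow> \<not> big (side (parcs T) K B)"
      by (rule E.small_branches) (fact not_both Pne)+
    ultimately show thesis using that by blast
  qed
  define Q where "Q = {u \<in> pverts C. bag u = K}"
  define I where "I = {u \<in> pverts C. bag u \<noteq> K}"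
  have "clique C Q"
    unfolding clique_def
  proof (intro conjI ballI impI)
    show "Q \<subseteq> pverts C" by (auto simp: Q_def)
    fix u v assume uv: "u \<in> Q" "v \<in> Q" "u \<noteq> v"
    then have "f u \<noteq> f v" using emb by (auto simp: induced_embedding_def inj_on_def Q_def)
    moreover have "f u \<in> K" "f v \<in> K" using uv bag by (auto simp: Q_def)
    ultimately have "(f u, f v) \<in> parcs G" using bags[rule_format, OF KP] by (auto simp: clique_def)
    then show "(u, v) \<in> parcs C" using arcs uv by (auto simp: Q_def)
  qed
  moreover have "independent C I"
    unfolding independent_def
  proof (intro conjI ballI notI)
    show "I \<subseteq> pverts C" by (auto simp: I_def)
    fix u v assume uv: "u \<in> I" "v \<in> I" "(u, v) \<in> parcs C"
    then have mem: "u \<in> pverts C" "v \<in> pverts C" "bag u \<noteq> K" "bag v \<noteq> K" by (auto simp: I_def)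
    have "u \<noteq> v" using uv arcs G.no_loops' by blast
    have "(K, bag u) \<in> (parcs T)\<^sup>*"
      using connected_imp_rtrancl[of T K "bag u"] T KP bag[OF mem(1)]
      by (auto simp: undirected_tree_def)
    \<comment> \<open>Adjacent vertices outside \<open>K\<close> lie over the same branch at
      \<open>K\<close>, since their bags are equal or joined by a tree edge avoiding
      \<open>K\<close>. That branch would then be big.\<close>
    then obtain B where B: "(K, B) \<in> parcs T" "bag u \<in> side (parcs T) K B"
      using E.in_side_of_neighbour mem by blast
    have "bag v \<in> side (parcs T) K B"
      using bag_adj[OF uv(3)]
    proof
      assume "(bag u, bag v) \<in> parcs T"
      then show ?thesis using side_step[OF B(2)] mem by blast
    qed (use B in simp)
    then have "card {u, v} \<le> card {u \<in> pverts C. bag u \<in> side (parcs T) K B}"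
      using B mem finC by (intro card_mono) auto
    then have "big (side (parcs T) K B)" using \<open>u \<noteq> v\<close> by (simp add: big_def)
    then show False using K[OF B(1)] by blast
  qed
  moreover have "Q \<union> I = pverts C" "Q \<inter> I = {}" by (auto simp: Q_def I_def)
  ultimately show ?thesis unfolding split_graph_def by blast
qed

section \<open>Cliques, stars and the conclusion for all components\<close>

lemma complete_graph_imp_split_graph: "complete_graph C \<Longrightarrow> split_graph C"
  unfolding split_graph_def complete_graph_def
  by (rule exI[of _ "pverts C"], rule exI[of _ "{}"]) (simp add: independent_def)

lemma star_graph_imp_split_graph:
  assumes "star_graph C" shows "split_graph C"
proof -
  from assms obtain c where c: "c \<in> pverts C"
    "parcs C = {c} \<times> (pverts C - {c}) \<union> (pverts C - {c}) \<times> {c}"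
    by (auto simp: star_graph_def)
  have "clique C {c}" using c(1) by (simp add: clique_def)
  moreover have "independent C (pverts C - {c})" unfolding independent_def c(2) by blast
  moreover have "{c} \<union> (pverts C - {c}) = pverts C" "{c} \<inter> (pverts C - {c}) = {}"
    using c(1) by auto
  ultimately show ?thesis unfolding split_graph_def by metis
qed

theorem theorem1:
  fixes G :: "'a pair_pre_digraph" and H :: "'a decomposition"
  assumes "well_partitioned_chordal G"
    and "minimal_split_decomposition G H"
  shows "\<forall>C\<in>components H. split_graph C"
proof
  fix C assume C: "C \<in> components H"
  have G: "pair_graph G" "connected G"
    using assms(1) by (auto simp: well_partitioned_chordal_def)
  have H: "split_decomposition G H"
    and kinds: "complete_graph C \<or> star_graph C \<or> prime_graph C"
    using assms(2) C
    by (auto simp: minimal_split_decomposition_def reduced_split_decomposition_def)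
  obtain f where "induced_embedding f C G"
    using split_decomposition_invariant[OF G H C] by blast
  then show "split_graph C"
    using kinds complete_graph_imp_split_graph star_graph_imp_split_graph
      prime_induced_imp_split_graph[OF assms(1)] by blast
qed

end
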